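(* Let $X$ be a complex Banach space and let $A,B\in\mathcal{B}(X)^D$ be $\{A,B\}$-weakly commutative. (i) If $AA^D(A+B)BB^D\in\mathcal{B}(X)^D$, then $$(A+B)^D=\left(AA^D(A+B)BB^D\right)^D+(I-AA^D)B^D\left(\sum_{n=0}^{i(A)-1}(-AB)^n(B^D)^{2n}\right)+\left(\sum_{n=0}^{i(B)-1}(A^D)^{2n}(-AB)^n\right)A^D(I-BB^D).$$ (ii) If $AA^D(A+B)\in\mathcal{B}(X)^D$, then $$(A+B)^D=\left(AA^D(A+B)\right)^D+(I-AA^D)B^D\left(\sum_{n=0}^{i(A)-1}(-AB)^n(B^D)^{2n}\right).$$ (iii) If $(A+B)BB^D\in\mathcal{B}(X)^D$, then $$(A+B)^D=\left((A+B)BB^D\right)^D+\left(\sum_{n=0}^{i(B)-1}(A^D)^{2n}(-AB)^n\right)A^D(I-BB^D).$$ (In each case the Drazin inverse of $A+B$ exists and is given by the stated formula.)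
   Context: $\mathcal{B}(X)$ is the algebra of bounded linear operators on the complex Banach space $X$, $I$ the identity operator. $A\in\mathcal{B}(X)$ is Drazin invertible if there is $A^D\in\mathcal{B}(X)$ (the Drazin inverse of $A$, unique when it exists) with $AA^D=A^DA$, $A^DAA^D=A^D$ and $A(I-AA^D)$ nilpotent; the index $i(A)$ is the least non-negative integer $k$ with $(A(I-AA^D))^k=0$; $\mathcal{B}(X)^D$ is the set of Drazin invertible operators. Operators $A,B\in\mathcal{B}(X)$ are $A$-weakly commutative if there is $C_1\in\mathcal{B}(X)$ with $AB=C_1A$ and $BA=AC_1$; they are $B$-weakly commutative if there is $C_2\in\mathcal{B}(X)$ with $AB=BC_2$ and $BA=C_2B$; they are $\{A,B\}$-weakly commutative if they are both $A$-weakly commutative and $B$-weakly commutative. *)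

theory Defs
  imports "HOL-Analysis.Analysis"
begin

text \<open>The scalar multiplication by complex numbers extends the real one, and the norm is
  homogeneous with respect to it; \<open>1 *\<^sub>C x = x\<close> follows from the corresponding real law.\<close>

class complex_normed_vector = real_normed_vector +
  fixes scaleC :: "complex \<Rightarrow> 'a \<Rightarrow> 'a"  (infixr \<open>*\<^sub>C\<close> 75)
  assumes scaleR_scaleC: "r *\<^sub>R x = complex_of_real r *\<^sub>C x"
    and scaleC_add_right: "a *\<^sub>C (x + y) = a *\<^sub>C x + a *\<^sub>C y"
    and scaleC_add_left: "(a + b) *\<^sub>C x = a *\<^sub>C x + b *\<^sub>C x"
    and scaleC_scaleC: "a *\<^sub>C b *\<^sub>C x = (a * b) *\<^sub>C x"
    and norm_scaleC: "norm (a *\<^sub>C x) = cmod a * norm x"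

class complex_banach = complex_normed_vector + complete_space

subclass (in complex_banach) banach ..

lemma scaleC_diff_right: "a *\<^sub>C (x - y) = a *\<^sub>C x - a *\<^sub>C (y :: 'a::complex_normed_vector)"
  by (metis add_diff_cancel diff_add_cancel scaleC_add_right)

lemma scaleC_zero_right [simp]: "a *\<^sub>C 0 = (0 :: 'a::complex_normed_vector)"
  using scaleC_diff_right[of a 0 0] by simp

lemma scaleC_minus_right: "a *\<^sub>C (- x) = - (a *\<^sub>C (x :: 'a::complex_normed_vector))"
  using scaleC_diff_right[of a 0 x] by simp

instantiation complex :: complex_banach
begin

definition scaleC_complex :: "complex \<Rightarrow> complex \<Rightarrow> complex"
  where "scaleC_complex a x = a * x"

instance
  by standard (simp_all add: scaleC_complex_def scaleR_conv_of_real algebra_simps norm_mult)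

end

text \<open>The operators are complex-linear. The underlying space may be \<open>{0}\<close>, in which case
  \<open>0 = 1\<close>; hence the instances of \<^class>\<open>ring\<close> and \<^class>\<open>monoid_mult\<close> instead of
  \<^class>\<open>ring_1\<close>.\<close>

typedef (overloaded) 'a bounded_op =
  "{f :: 'a \<Rightarrow> 'a::complex_normed_vector. bounded_linear f \<and> (\<forall>c x. f (c *\<^sub>C x) = c *\<^sub>C f x)}"
  morphisms apply_op Bounded_Op
  by (rule exI[of _ "\<lambda>x. x"]) simp

setup_lifting type_definition_bounded_op

instantiation bounded_op :: (complex_normed_vector) ring
begin

lift_definition zero_bounded_op :: "'a bounded_op" is "\<lambda>x. 0"
  by simp

lift_definition plus_bounded_op :: "'a bounded_op \<Rightarrow> 'a bounded_op \<Rightarrow> 'a bounded_op"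
  is "\<lambda>f g x. f x + g x"
  by (simp add: bounded_linear_add scaleC_add_right)

lift_definition uminus_bounded_op :: "'a bounded_op \<Rightarrow> 'a bounded_op"
  is "\<lambda>f x. - f x"
  by (simp add: bounded_linear_minus scaleC_minus_right)

lift_definition minus_bounded_op :: "'a bounded_op \<Rightarrow> 'a bounded_op \<Rightarrow> 'a bounded_op"
  is "\<lambda>f g x. f x - g x"
  by (simp add: bounded_linear_sub scaleC_diff_right)

lift_definition times_bounded_op :: "'a bounded_op \<Rightarrow> 'a bounded_op \<Rightarrow> 'a bounded_op"
  is "\<lambda>f g x. f (g x)"
  by (simp add: bounded_linear_compose)

instance
proof
  fix a b c :: "'a bounded_op"
  show "a + b + c = a + (b + c)"
    by transfer (simp add: add.assoc)
  show "a + b = b + a"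
    by transfer (simp add: add.commute)
  show "0 + a = a"
    by transfer simp
  show "- a + a = 0"
    by transfer simp
  show "a - b = a + - b"
    by transfer simp
  show "a * b * c = a * (b * c)"
    by transfer simp
  show "(a + b) * c = a * c + b * c"
    by transfer simp
  show "a * (b + c) = a * b + a * c"
    by transfer (simp add: linear_simps)
qed

end

instantiation bounded_op :: (complex_normed_vector) monoid_mult
begin

lift_definition one_bounded_op :: "'a bounded_op" is "\<lambda>x. x"
  by simp

instance
  by standard (transfer; simp)+

end

definition nilpotent :: "'a::{ring, monoid_mult} \<Rightarrow> bool"
  where "nilpotent N \<longleftrightarrow> (\<exists>k. N ^ k = 0)"

definition is_drazin_inverse :: "'a::{ring, monoid_mult} \<Rightarrow> 'a \<Rightarrow> bool"
  where "is_drazin_inverse A D \<longleftrightarrow>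
    A * D = D * A \<and> D * A * D = D \<and> nilpotent (A * (1 - A * D))"

definition drazin_invertible :: "'a::{ring, monoid_mult} \<Rightarrow> bool"
  where "drazin_invertible A \<longleftrightarrow> (\<exists>D. is_drazin_inverse A D)"

definition drazin_inverse :: "'a::{ring, monoid_mult} \<Rightarrow> 'a"  (\<open>(\<open>notation=\<open>postfix D\<close>\<close>_\<^sup>D)\<close> [1000] 999)
  where "A\<^sup>D = (THE D. is_drazin_inverse A D)"

text \<open>As \<open>N ^ 0 = 1\<close>, the index of an invertible operator on a nonzero space is \<open>1\<close>, not \<open>0\<close>.\<close>

definition drazin_index :: "'a::{ring, monoid_mult} \<Rightarrow> nat"
  where "drazin_index A = (LEAST k. (A * (1 - A * A\<^sup>D)) ^ k = 0)"

lemma drazin_power_stable: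
  fixes A D :: "'a::{ring, monoid_mult}"
  assumes "is_drazin_inverse A D"
  obtains n where "A ^ n = A ^ n * (A * D)"
proof -
  from assms have c: "A * D = D * A" and d: "D * A * D = D"
    and "nilpotent (A * (1 - A * D))"
    by (auto simp: is_drazin_inverse_def)
  then obtain k where k: "(A * (1 - A * D)) ^ k = 0"
    by (auto simp: nilpotent_def)
  define P where "P = 1 - A * D"
  have "A * D * (A * D) = A * (D * A * D)"
    by (simp only: mult.assoc)
  then have "A * D * (A * D) = A * D"
    by (simp only: d)
  then have PP: "P * P = P"
    unfolding P_def by (simp only: left_diff_distrib right_diff_distrib mult_1_left mult_1_right) simp
  have "A * D * A = A * (A * D)"
    by (simp only: mult.assoc c[symmetric])
  then have AP: "P * A = A * P"
    unfolding P_def by (simp only: left_diff_distrib right_diff_distrib mult_1_left mult_1_right)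
  have "(A * P) ^ m * P = A ^ m * P" for m
  proof (induction m)
    case (Suc m)
    have "(A * P) ^ Suc m * P = A * P * ((A * P) ^ m * P)"
      by (simp only: power_Suc mult.assoc)
    also have "\<dots> = A * (P * A ^ m) * P"
      by (simp only: Suc mult.assoc)
    also have "P * A ^ m = A ^ m * P"
      using power_commuting_commutes[of A P m] AP by simp
    also have "A * (A ^ m * P) * P = A ^ Suc m * (P * P)"
      by (simp only: power_Suc mult.assoc)
    finally show ?case
      by (simp only: PP)
  qed simp
  from this[of k] have "A ^ k * P = 0"
    using k by (simp add: P_def)
  then have "A ^ k = A ^ k * (A * D)"
    unfolding P_def by (simp only: right_diff_distrib mult_1_right right_minus_eq)
  then show thesis
    by (rule that)
qed

lemma is_drazin_inverse_absorb:
  fixes A D E :: "'a::{ring, monoid_mult}"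
  assumes D: "is_drazin_inverse A D" and E: "is_drazin_inverse A E"
  shows "D = A * E * D" "D = D * (A * E)"
proof -
  have c: "A * D = D * A" and d: "D * A * D = D" and e: "A * E = E * A"
    using D E by (auto simp: is_drazin_inverse_def)
  have left: "D = A ^ n * D ^ Suc n" for n
  proof (induction n)
    case (Suc n)
    have "D = A * D * D"
      by (simp only: c d)
    also have "\<dots> = A * (A ^ n * D ^ Suc n) * D"
      using Suc by simp
    also have "\<dots> = A ^ Suc n * D ^ Suc (Suc n)"
      by (simp only: power_Suc[of A] power_Suc2[of D "Suc n"] mult.assoc)
    finally show ?case .
  qed simp
  have right: "D = D ^ Suc n * A ^ n" for n
  proof -
    have "A ^ n * D = D * A ^ n"
      using c by (rule power_commuting_commutes)
    then have "D ^ Suc n * A ^ n = A ^ n * D ^ Suc n"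
      using power_commuting_commutes[of D "A ^ n" "Suc n"] by simp
    then show ?thesis
      using left[of n] by simp
  qed
  obtain n where n: "A ^ n = A ^ n * (A * E)"
    using drazin_power_stable[OF E] .
  have "A * E * A = A * (A * E)"
    by (simp only: mult.assoc e[symmetric])
  then have n': "A ^ n = A * E * A ^ n"
    using n power_commuting_commutes[of A "A * E" n] by simp
  have "D = A * E * A ^ n * D ^ Suc n"
    using left[of n] n' by simp
  then show "D = A * E * D"
    using left[of n] by (simp only: mult.assoc)
  have "D = D ^ Suc n * (A ^ n * (A * E))"
    using right[of n] n by simp
  then show "D = D * (A * E)"
    using right[of n] by (simp only: mult.assoc[symmetric])
qed

lemma is_drazin_inverse_unique:
  fixes A D E :: "'a::{ring, monoid_mult}"
  assumes D: "is_drazin_inverse A D" and E: "is_drazin_inverse A E"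
  shows "D = E"
proof -
  have "A * E = E * A"
    using E by (simp add: is_drazin_inverse_def)
  then have "D = E * (A * D)"
    using is_drazin_inverse_absorb(1)[OF D E] by (simp only: mult.assoc)
  also have "\<dots> = E"
    using is_drazin_inverse_absorb(2)[OF E D] by simp
  finally show ?thesis .
qed

lemma drazin_inverse_eq: "is_drazin_inverse A D \<Longrightarrow> A\<^sup>D = D"
  unfolding drazin_inverse_def by (blast intro: is_drazin_inverse_unique)

lemma drazin_invertible_is_drazin_inverse:
  "drazin_invertible A \<Longrightarrow> is_drazin_inverse A (A\<^sup>D)"
  using drazin_inverse_eq by (auto simp: drazin_invertible_def)

text \<open>For a pair \<open>A, B\<close> these are \<open>A\<close>-weak, \<open>B\<close>-weak and \<open>{A, B}\<close>-weak commutativity.\<close>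

definition fst_weakly_commutative :: "'a::monoid_mult \<Rightarrow> 'a \<Rightarrow> bool"
  where "fst_weakly_commutative A B \<longleftrightarrow> (\<exists>C. A * B = C * A \<and> B * A = A * C)"

definition snd_weakly_commutative :: "'a::monoid_mult \<Rightarrow> 'a \<Rightarrow> bool"
  where "snd_weakly_commutative A B \<longleftrightarrow> (\<exists>C. A * B = B * C \<and> B * A = C * B)"

definition weakly_commutative :: "'a::monoid_mult \<Rightarrow> 'a \<Rightarrow> bool"
  where "weakly_commutative A B \<longleftrightarrow> fst_weakly_commutative A B \<and> snd_weakly_commutative A B"

end

theory Submission
  imports Defs
begin

text \<open>
  Write \<open>P = A A\<^sup>D\<close>, \<open>Q = B B\<^sup>D\<close>, \<open>S = A + B\<close>. The argument
  uses only that \<open>A\<close> and \<open>B\<close> are elements of a ring \<open>R\<close>.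

  Weak commutativity with respect to \<open>A\<close> allows \<open>B\<close> to be moved past any power of \<open>A\<close>, at the price
  of replacing \<open>B\<close> by another element: \<open>B A^k \<in> A^k R\<close> and \<open>A^k B \<in> R A^k\<close>. As \<open>P\<close> lies in
  \<open>A^k R\<close> and in \<open>R A^k\<close> for every \<open>k\<close>, whereas \<open>A^k (1 - P) = 0\<close> for large \<open>k\<close>, both
  \<open>(1 - P) B P\<close> and \<open>P B (1 - P)\<close> vanish, so \<open>P\<close> commutes with \<open>B\<close>; likewise \<open>Q\<close> commutes with
  \<open>A\<close>. Hence \<open>S\<close> splits along the four orthogonal idempotents \<open>P Q\<close>, \<open>(1 - P) Q\<close>, \<open>P (1 - Q)\<close>
  and \<open>(1 - P) (1 - Q)\<close>, and Drazin inverses of orthogonal summands add up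
  (\<open>is_drazin_inverse_add\<close>).

  On \<open>(1 - P) Q\<close> the operator \<open>B\<close> is invertible and \<open>A\<close> is nilpotent. There
  \<open>S = (1 + A B\<^sup>D) B\<close>, and \<open>A B\<^sup>D = A B (B\<^sup>D)\<^sup>2\<close> is nilpotent because \<open>(A B)^k \<in> A^k R\<close>; so \<open>S\<close> is
  inverted by a finite geometric series, which is the sum in the formula. On
  \<open>P (1 - Q)\<close> the same holds with \<open>A\<close> and \<open>B\<close> exchanged. On \<open>(1 - P) (1 - Q)\<close> both are nilpotent,
  and so is \<open>S\<close>: a word with \<open>i\<close> letters \<open>A\<close> and \<open>j\<close> letters \<open>B\<close> lies in \<open>A^i R\<close> and in \<open>B^j R\<close>.
  On \<open>P Q\<close> the Drazin inverse is the one whose existence is assumed; under the hypotheses of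
  the last two formulas it is assumed on all of \<open>P\<close> or on all of \<open>Q\<close>.
\<close>

section \<open>Idempotents and Drazin inverses\<close>

lemma commute_minus_one:
  fixes P X :: "'r::{ring, monoid_mult}"
  assumes "P * X = X * P"
  shows "(1 - P) * X = X * (1 - P)"
  using assms by (simp add: algebra_simps)

lemma idempotent_complement:
  fixes P :: "'r::{ring, monoid_mult}"
  assumes "P * P = P"
  shows "(1 - P) * (1 - P) = 1 - P"
  using assms by (simp add: algebra_simps)

lemma power_mult_distrib_commuting:
  fixes x y :: "'r::monoid_mult"
  assumes "y * x = x * y"
  shows "x ^ n * y ^ n = (x * y) ^ n" "y ^ n * x ^ n = (y * x) ^ n"
proof -
  have *: "x ^ n * y ^ n = (x * y) ^ n" if "y * x = x * y" for x y :: 'r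
  proof (induction n)
    case (Suc n)
    have "x ^ n * y = y * x ^ n"
      using that by (intro power_commuting_commutes) simp
    then have "x * (x ^ n * y) * y ^ n = x * y * (x ^ n * y ^ n)"
      by (simp add: mult.assoc)
    then have "x ^ Suc n * y ^ Suc n = x * y * (x ^ n * y ^ n)"
      by (simp add: mult.assoc)
    then show ?case
      using Suc by simp
  qed simp
  show "x ^ n * y ^ n = (x * y) ^ n" "y ^ n * x ^ n = (y * x) ^ n"
    using *[of y x] *[of x y] assms by simp_all
qed

lemma power_corner:
  fixes E S :: "'r::{ring, monoid_mult}"
  assumes EE: "E * E = E" and ES: "E * S = S * E"
  shows "(S * E) ^ m * E = S ^ m * E"
proof (induction m)
  case (Suc m)
  have "E * S ^ m = S ^ m * E"
    using power_commuting_commutes[of S E m] ES by simp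
  then have "S * E * (S ^ m * E) = S * (S ^ m * E)"
    by (metis EE mult.assoc)
  then show ?case
    using Suc by (simp add: mult.assoc)
qed simp

lemma nilpotent_corner:
  fixes E S :: "'r::{ring, monoid_mult}"
  assumes EE: "E * E = E" and ES: "E * S = S * E" and "S ^ m * E = 0"
  shows "nilpotent (S * E)"
proof -
  have "(S * E) ^ m * E * S = 0"
    using assms by (simp add: power_corner)
  then have "(S * E) ^ Suc m = 0"
    by (simp add: power_Suc2 mult.assoc ES del: power_Suc)
  then show ?thesis
    unfolding nilpotent_def by blast
qed

lemma nilpotent_orthogonal_add:
  fixes U V :: "'r::{ring, monoid_mult}"
  assumes UV: "U * V = 0" and VU: "V * U = 0" and "nilpotent U" "nilpotent V"
  shows "nilpotent (U + V)"
proof -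
  have pow: "(U + V) ^ Suc n = U ^ Suc n + V ^ Suc n" for n
  proof (induction n)
    case (Suc n)
    have "(U + V) ^ Suc (Suc n) = (U + V) * (U ^ Suc n + V ^ Suc n)"
      using Suc by simp
    also have "\<dots> = U * U ^ Suc n + (U * V) * V ^ n + ((V * U) * U ^ n + V * V ^ Suc n)"
      by (simp add: distrib_left distrib_right mult.assoc)
    finally show ?case
      by (simp add: UV VU)
  qed simp
  obtain i j where i: "U ^ i = 0" and j: "V ^ j = 0"
    using assms by (auto simp: nilpotent_def)
  have "U ^ Suc (i + j) = 0"
    by (simp add: power_add i)
  moreover have "V ^ Suc (i + j) = 0"
    by (simp add: power_add j)
  ultimately have "(U + V) ^ Suc (i + j) = 0"
    by (simp add: pow del: power_Suc)
  then show ?thesis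
    unfolding nilpotent_def by blast
qed

lemma is_drazin_inverse_add:
  fixes X Y D E :: "'r::{ring, monoid_mult}"
  assumes X: "is_drazin_inverse X D" and Y: "is_drazin_inverse Y E"
    and XY: "X * Y = 0" and YX: "Y * X = 0"
  shows "is_drazin_inverse (X + Y) (D + E)"
proof -
  have cX: "X * D = D * X" and dX: "D * X * D = D" and nX: "nilpotent (X * (1 - X * D))"
    and cY: "Y * E = E * Y" and dY: "E * Y * E = E" and nY: "nilpotent (Y * (1 - Y * E))"
    using X Y by (auto simp: is_drazin_inverse_def)
  \<comment> \<open>\<open>D \<in> X R \<inter> R X\<close> and \<open>E \<in> Y R \<inter> R Y\<close>, so all mixed products vanish.\<close>
  have DX: "D = X * (D * D)" "D = D * D * X"
    by (metis cX dX mult.assoc)+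
  have EY: "E = Y * (E * E)" "E = E * E * Y"
    by (metis cY dY mult.assoc)+
  have XE: "X * E = 0" by (metis EY(1) XY mult.assoc mult_zero_left)
  have EX: "E * X = 0" by (metis EY(2) YX mult.assoc mult_zero_right)
  have YD: "Y * D = 0" by (metis DX(1) YX mult.assoc mult_zero_left)
  have DY: "D * Y = 0" by (metis DX(2) XY mult.assoc mult_zero_right)
  have prod: "(X + Y) * (D + E) = X * D + Y * E"
    by (simp add: distrib_left distrib_right XE YD)
  have "(D + E) * (X + Y) = D * X + E * Y"
    by (simp add: distrib_left distrib_right EX DY)
  moreover have "(D * X + E * Y) * (D + E) = D + E"
    using dX dY by (simp add: distrib_left distrib_right mult.assoc XE YD)
  moreover have "nilpotent ((X + Y) * (1 - (X * D + Y * E)))"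
  proof -
    have "X * (Y * E) = 0" "Y * (X * D) = 0"
      by (simp_all add: mult.assoc[symmetric] XY YX)
    then have "(X + Y) * (1 - (X * D + Y * E)) = X * (1 - X * D) + Y * (1 - Y * E)"
      by (simp add: algebra_simps)
    moreover have "X * (1 - X * D) * Y = 0" "Y * (1 - Y * E) * X = 0"
      by (simp_all add: left_diff_distrib right_diff_distrib mult.assoc XY YX DY EX)
    then have "X * (1 - X * D) * (Y * (1 - Y * E)) = 0" "Y * (1 - Y * E) * (X * (1 - X * D)) = 0"
      by (simp_all add: mult.assoc[symmetric])
    ultimately show ?thesis
      using nilpotent_orthogonal_add nX nY by simp
  qed
  ultimately show ?thesis
    unfolding is_drazin_inverse_def by (simp add: prod cX cY)
qed

lemma drazin_projection:
  fixes A D :: "'r::{ring, monoid_mult}"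
  assumes "is_drazin_inverse A D"
  shows "A * D * (A * D) = A * D" "A * D * A = A * (A * D)" "A * D * D = D" "D * (A * D) = D"
  using assms unfolding is_drazin_inverse_def by (metis mult.assoc)+

lemma drazin_projection_factor:
  fixes A D :: "'r::{ring, monoid_mult}"
  assumes "is_drazin_inverse A D"
  shows "\<exists>Z. A * D = A ^ k * Z" "\<exists>Z. A * D = Z * A ^ k"
proof -
  note P = drazin_projection[OF assms]
  have c: "A * D = D * A"
    using assms by (simp add: is_drazin_inverse_def)
  then have ck: "A ^ k * D = D * A ^ k" for k
    by (rule power_commuting_commutes)
  show "\<exists>Z. A * D = A ^ k * Z"
  proof (induction k)
    case (Suc k)
    then obtain Z where Z: "A * D = A ^ k * Z"
      by blast
    have "A * D = A * D * (A ^ k * Z)"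
      by (metis P(1) Z)
    also have "\<dots> = A * (D * A ^ k) * Z"
      by (simp only: mult.assoc)
    also have "\<dots> = A ^ Suc k * (D * Z)"
      by (simp add: ck[symmetric] mult.assoc)
    finally show ?case by blast
  qed simp
  show "\<exists>Z. A * D = Z * A ^ k"
  proof (induction k)
    case (Suc k)
    then obtain Z where Z: "A * D = Z * A ^ k"
      by blast
    have "A * D = Z * A ^ k * (D * A)"
      by (metis P(1) Z c)
    also have "\<dots> = Z * (A ^ k * D) * A"
      by (simp only: mult.assoc)
    also have "\<dots> = Z * D * A ^ Suc k"
      by (simp only: ck power_Suc2 mult.assoc)
    finally show ?case by blast
  qed simp
qed

text \<open>An element that commutes with \<open>u\<close> also commutes with an inverse \<open>v\<close> of \<open>u\<close> in the corner of
  the idempotent \<open>q\<close>. Besides \<open>v = A\<^sup>D\<close> it is needed for \<open>v = (A\<^sup>D)\<^sup>2\<close>.\<close>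

lemma corner_inverse_commute:
  fixes u v q c :: "'r::monoid_mult"
  assumes "u * v = q" "v * u = q" "q * v = v" "v * q = v" "q * c = c * q" "u * c = c * u"
  shows "v * c = c * v"
proof -
  have "v * c = v * (c * q)"
    by (metis assms(4,5) mult.assoc)
  also have "\<dots> = v * (u * c) * v"
    by (simp only: assms(1)[symmetric] assms(6) mult.assoc)
  also have "\<dots> = c * (q * v)"
    by (simp only: assms(2,5) mult.assoc[symmetric])
  finally show ?thesis
    by (simp only: assms(3))
qed

lemma power_drazin_index:
  fixes A :: "'r::{ring, monoid_mult}"
  assumes "drazin_invertible A"
  shows "A ^ drazin_index A * (1 - A * A\<^sup>D) = 0"
proof -
  note A = drazin_invertible_is_drazin_inverse[OF assms]
  then have "\<exists>k. (A * (1 - A * A\<^sup>D)) ^ k = 0"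
    unfolding is_drazin_inverse_def nilpotent_def by blast
  then have "(A * (1 - A * A\<^sup>D)) ^ drazin_index A = 0"
    unfolding drazin_index_def by (rule LeastI_ex)
  then show ?thesis
    using power_corner[OF idempotent_complement[OF drazin_projection(1)[OF A]]
        commute_minus_one[OF drazin_projection(2)[OF A]]]
    by (metis mult_zero_left)
qed

section \<open>Weak commutativity\<close>

lemma weakly_commutative_sym:
  "weakly_commutative A B \<Longrightarrow> weakly_commutative B A"
  unfolding weakly_commutative_def fst_weakly_commutative_def snd_weakly_commutative_def
  by metis

lemma weakly_commutative_imp_fst:
  "weakly_commutative A B \<Longrightarrow> fst_weakly_commutative A B"
  by (simp add: weakly_commutative_def)

text \<open>Passing one factor \<open>A\<close> exchanges \<open>B\<close> and \<open>C\<close>, and the relations are symmetric under this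
  exchange; so the procedure can be repeated.\<close>

lemma fst_weakly_commutative_power:
  assumes "fst_weakly_commutative A B"
  shows "\<exists>Y. B * A ^ k = A ^ k * Y" "\<exists>Y. A ^ k * B = Y * A ^ k"
proof -
  obtain C where C: "A * B = C * A" "B * A = A * C"
    using assms by (auto simp: fst_weakly_commutative_def)
  have "\<exists>Y Z. B * A ^ k = A ^ k * Y \<and> A ^ k * B = Y * A ^ k
      \<and> C * A ^ k = A ^ k * Z \<and> A ^ k * C = Z * A ^ k"
  proof (induction k)
    case (Suc k)
    then obtain Y Z where "B * A ^ k = A ^ k * Y" "A ^ k * B = Y * A ^ k"
      "C * A ^ k = A ^ k * Z" "A ^ k * C = Z * A ^ k"
      by blast
    then have "B * A ^ Suc k = A ^ Suc k * Z" "A ^ Suc k * B = Z * A ^ Suc k"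
      "C * A ^ Suc k = A ^ Suc k * Y" "A ^ Suc k * C = Y * A ^ Suc k"
      using C by (metis power_Suc power_Suc2 mult.assoc)+
    then show ?case by blast
  qed auto
  then show "\<exists>Y. B * A ^ k = A ^ k * Y" "\<exists>Y. A ^ k * B = Y * A ^ k"
    by blast+
qed

lemma fst_weakly_commutative_square:
  assumes "fst_weakly_commutative A B"
  shows "A * A * B = B * (A * A)"
  using assms unfolding fst_weakly_commutative_def by (metis mult.assoc)

lemma fst_weakly_commutative_prod_power:
  fixes A B :: "'r::{ring, monoid_mult}"
  assumes "fst_weakly_commutative A B"
  shows "\<exists>X. (- (A * B)) ^ k = A ^ k * X"
proof (induction k)
  case (Suc k)
  then obtain X where X: "(- (A * B)) ^ k = A ^ k * X"
    by blast
  obtain Y where Y: "B * A ^ k = A ^ k * Y"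
    using fst_weakly_commutative_power(1)[OF assms] by blast
  have "(- (A * B)) ^ Suc k = - (A * (B * A ^ k) * X)"
    by (simp add: X mult.assoc)
  also have "\<dots> = A ^ Suc k * (- (Y * X))"
    by (simp add: Y mult.assoc)
  finally show ?case by blast
qed simp

text \<open>A word in \<open>A\<close> and \<open>B\<close> of length \<open>i + j\<close> has at least \<open>i\<close> letters \<open>A\<close> or at least \<open>j\<close>
  letters \<open>B\<close>, and the letters of one kind can be collected on the left.\<close>

lemma weakly_commutative_add_power:
  fixes A B :: "'r::{ring, monoid_mult}"
  assumes "weakly_commutative A B"
  shows "\<exists>X Y. (A + B) ^ (i + j) = A ^ i * X + B ^ j * Y"
proof (induction "i + j" arbitrary: i j)
  case 0
  then show ?case
    by (intro exI[of _ 1] exI[of _ 0]) simp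
next
  case (Suc n)
  show ?case
  proof (cases "i = 0 \<or> j = 0")
    case True
    then show ?thesis
    proof
      assume "i = 0"
      then show ?thesis
        by (intro exI[of _ "(A + B) ^ (i + j)"] exI[of _ 0]) simp
    next
      assume "j = 0"
      then show ?thesis
        by (intro exI[of _ 0] exI[of _ "(A + B) ^ (i + j)"]) simp
    qed
  next
    case False
    then obtain i' j' where ij: "i = Suc i'" "j = Suc j'"
      by (metis not0_implies_Suc)
    with Suc have n: "n = i' + j" "n = i + j'"
      by auto
    obtain X Y where XY: "(A + B) ^ n = A ^ i' * X + B ^ j * Y"
      using Suc(1)[OF n(1)] n by auto
    obtain X' Y' where XY': "(A + B) ^ n = A ^ i * X' + B ^ j' * Y'"
      using Suc(1)[OF n(2)] n by auto
    obtain V where V: "B * A ^ i = A ^ i * V"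
      using fst_weakly_commutative_power(1) weakly_commutative_imp_fst[OF assms] by blast
    obtain W where W: "A * B ^ j = B ^ j * W"
      using fst_weakly_commutative_power(1)
        weakly_commutative_imp_fst[OF weakly_commutative_sym[OF assms]] by blast
    have "(A + B) ^ (i + j) = A * (A + B) ^ n + B * (A + B) ^ n"
      by (simp add: Suc(2)[symmetric] distrib_right)
    also have "A * (A + B) ^ n = A ^ i * X + A * B ^ j * Y"
      by (simp add: XY ij distrib_left mult.assoc)
    also have "B * (A + B) ^ n = B * A ^ i * X' + B ^ j * Y'"
      by (simp add: XY' ij distrib_left mult.assoc)
    finally have "(A + B) ^ (i + j) = A ^ i * (X + V * X') + B ^ j * (W * Y + Y')"
      by (simp add: V W distrib_left mult.assoc add_ac)
    then show ?thesis by blast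
  qed
qed

text \<open>With \<open>P = A D\<close>, the two halves of the proof are \<open>(1 - P) B P = 0\<close> and
  \<open>P B (1 - P) = 0\<close>: since \<open>P\<close> factors through \<open>A^n\<close> on both sides, \<open>B P \<in> A^n R\<close> and
  \<open>P B \<in> R A^n\<close>, and \<open>P\<close> acts as a unit on \<open>A^n\<close> once \<open>n\<close> is large.\<close>

lemma drazin_projection_commute:
  fixes A B D :: "'r::{ring, monoid_mult}"
  assumes D: "is_drazin_inverse A D" and "fst_weakly_commutative A B"
  shows "A * D * B = B * (A * D)"
proof -
  obtain n where n: "A ^ n = A ^ n * (A * D)"
    using drazin_power_stable[OF D] .
  have n': "A ^ n = A * D * A ^ n"
    using n power_commuting_commutes[of A "A * D" n] drazin_projection(2)[OF D] by simp
  obtain Z Z' where Z: "A * D = A ^ n * Z" and Z': "A * D = Z' * A ^ n"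
    using drazin_projection_factor[OF D] by blast
  obtain Y Y' where Y: "B * A ^ n = A ^ n * Y" and Y': "A ^ n * B = Y' * A ^ n"
    using fst_weakly_commutative_power[OF assms(2)] by blast
  have "A * D * (B * (A * D)) = A * D * A ^ n * Y * Z"
    by (metis Y Z mult.assoc)
  also have "\<dots> = B * (A * D)"
    by (metis Y Z n' mult.assoc)
  finally have "B * (A * D) = A * D * (B * (A * D))" ..
  also have "\<dots> = Z' * Y' * (A ^ n * (A * D))"
    by (metis Y' Z' mult.assoc)
  also have "\<dots> = A * D * B"
    by (metis Y' Z' n mult.assoc)
  finally show ?thesis ..
qed

lemma drazin_inverse_commute:
  fixes A D X :: "'r::{ring, monoid_mult}"
  assumes D: "is_drazin_inverse A D" and AX: "A * X = X * A"
  shows "D * X = X * D"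
proof (rule corner_inverse_commute[where u = A and q = "A * D"])
  have "fst_weakly_commutative A X"
    \<comment> \<open>A commuting pair is weakly commutative with \<open>C = X\<close>.\<close>
    unfolding fst_weakly_commutative_def using AX by metis
  then show "A * D * X = X * (A * D)"
    by (rule drazin_projection_commute[OF D])
qed (use D AX drazin_projection[OF D] in \<open>auto simp: is_drazin_inverse_def\<close>)

lemma drazin_inverse_square_commute:
  fixes A B D :: "'r::{ring, monoid_mult}"
  assumes D: "is_drazin_inverse A D" and "fst_weakly_commutative A B"
  shows "D * D * B = B * (D * D)"
proof (rule corner_inverse_commute[where u = "A * A" and q = "A * D"])
  have "A * D = D * A"
    using D by (simp add: is_drazin_inverse_def)
  then show "A * A * (D * D) = A * D" "D * D * (A * A) = A * D"
    "A * D * (D * D) = D * D" "D * D * (A * D) = D * D"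
    using drazin_projection[OF D] by (metis mult.assoc)+
qed (use assms in \<open>simp_all add: drazin_projection_commute fst_weakly_commutative_square\<close>)

section \<open>The corners on which one of the operators is nilpotent\<close>

lemma geometric_sum_inverse:
  fixes x :: "'r::{ring, monoid_mult}"
  shows "(1 - x) * (\<Sum>n<k. x ^ n) = 1 - x ^ k" "(\<Sum>n<k. x ^ n) * (1 - x) = 1 - x ^ k"
proof -
  show right: "(1 - x) * (\<Sum>n<k. x ^ n) = 1 - x ^ k" for k
  proof (induction k)
    case (Suc k)
    then show ?case
      by (simp add: distrib_left) (simp add: left_diff_distrib)
  qed simp
  have "x * (\<Sum>n<k. x ^ n) = (\<Sum>n<k. x ^ n) * x"
    by (simp add: sum_distrib_left sum_distrib_right power_commutes)
  then have "(1 - x) * (\<Sum>n<k. x ^ n) = (\<Sum>n<k. x ^ n) * (1 - x)"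
    by (intro commute_minus_one)
  with right show "(\<Sum>n<k. x ^ n) * (1 - x) = 1 - x ^ k"
    by simp
qed

text \<open>The Drazin inverse of \<open>A + B\<close> on the corner of \<open>1 - A A\<^sup>D\<close>, where \<open>A\<close> is nilpotent, written
  as \<open>B\<^sup>D\<close> times a geometric series. Exchanging \<open>A\<close> and \<open>B\<close> gives the one on the corner of
  \<open>1 - B B\<^sup>D\<close>, so that a single computation serves for both.\<close>

definition nilpotent_part_inverse :: "'r::{ring, monoid_mult} \<Rightarrow> 'r \<Rightarrow> 'r"
  where "nilpotent_part_inverse A B =
    (1 - A * A\<^sup>D) * B\<^sup>D * (\<Sum>n<drazin_index A. (- (A * B\<^sup>D)) ^ n)"

text \<open>Although \<open>B\<^sup>D\<close> need not commute with \<open>A\<close>, its square does, because \<open>B\<^sup>2\<close> does. This turns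
  the terms of the two sums into powers of a single element.\<close>

lemma power_prod_drazin:
  fixes A B :: "'r::{ring, monoid_mult}"
  assumes "drazin_invertible B" and "fst_weakly_commutative B A"
  shows "(- (A * B)) ^ n * (B\<^sup>D) ^ (2 * n) = (- (A * B\<^sup>D)) ^ n"
    and "(B\<^sup>D) ^ (2 * n) * (- (B * A)) ^ n = (- (B\<^sup>D * A)) ^ n"
proof -
  note B = drazin_invertible_is_drazin_inverse[OF assms(1)]
  define v where "v = B\<^sup>D * B\<^sup>D"
  have cB: "B * B\<^sup>D = B\<^sup>D * B"
    using B by (simp add: is_drazin_inverse_def)
  have vA: "v * A = A * v"
    unfolding v_def by (rule drazin_inverse_square_commute[OF B assms(2)])
  have Bv: "B * v = B\<^sup>D" and vB: "v * B = B\<^sup>D"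
    unfolding v_def using drazin_projection(3,4)[OF B] cB by (metis mult.assoc)+
  have pow: "(B\<^sup>D) ^ (2 * n) = v ^ n" for n
    by (simp add: v_def power_mult power2_eq_square)
  have "v * (A * B) = A * (v * B)" "v * (B * A) = v * B * A" "B * A * v = B * v * A"
    by (metis vA mult.assoc)+
  then have 1: "(- (A * B)) * v = - (A * B\<^sup>D)" and 2: "v * (- (B * A)) = - (B\<^sup>D * A)"
    and cv: "v * (- (A * B)) = - (A * B) * v" "v * (- (B * A)) = - (B * A) * v"
    by (simp_all add: vB Bv mult.assoc[of A])
  show "(- (A * B)) ^ n * (B\<^sup>D) ^ (2 * n) = (- (A * B\<^sup>D)) ^ n"
    unfolding pow 1[symmetric] using cv(1) by (rule power_mult_distrib_commuting(1))
  show "(B\<^sup>D) ^ (2 * n) * (- (B * A)) ^ n = (- (B\<^sup>D * A)) ^ n"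
    unfolding pow 2[symmetric] using cv(2) by (rule power_mult_distrib_commuting(2))
qed

lemma nilpotent_part_inverse_eq:
  fixes A B :: "'r::{ring, monoid_mult}"
  assumes "drazin_invertible B" and "weakly_commutative A B"
  shows "nilpotent_part_inverse A B =
    (1 - A * A\<^sup>D) * B\<^sup>D * (\<Sum>n<drazin_index A. (- (A * B)) ^ n * (B\<^sup>D) ^ (2 * n))"
  unfolding nilpotent_part_inverse_def
  using power_prod_drazin(1)[OF assms(1)
      weakly_commutative_imp_fst[OF weakly_commutative_sym[OF assms(2)]]]
  by simp

text \<open>The roles of the operators are exchanged here, but the product \<open>A B\<close> and the order of the
  factors are not. They are matched by shifting \<open>A\<^sup>D\<close> through the series:
  \<open>A\<^sup>D (B A\<^sup>D)^n = (A\<^sup>D B)^n A\<^sup>D\<close>.\<close>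

lemma nilpotent_part_inverse_swap_eq:
  fixes A B :: "'r::{ring, monoid_mult}"
  assumes A: "drazin_invertible A" and B: "drazin_invertible B" and AB: "weakly_commutative A B"
  shows "nilpotent_part_inverse B A =
    (\<Sum>n<drazin_index B. (A\<^sup>D) ^ (2 * n) * (- (A * B)) ^ n) * A\<^sup>D * (1 - B * B\<^sup>D)"
proof -
  note dA = drazin_invertible_is_drazin_inverse[OF A]
    and dB = drazin_invertible_is_drazin_inverse[OF B]
  have QA: "B * B\<^sup>D * A = A * (B * B\<^sup>D)"
    using drazin_projection_commute[OF dB weakly_commutative_imp_fst[OF weakly_commutative_sym[OF AB]]] .
  have QAD: "A\<^sup>D * (B * B\<^sup>D) = B * B\<^sup>D * A\<^sup>D"
    using drazin_inverse_commute[OF dA QA[symmetric]] .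
  have QE: "(1 - B * B\<^sup>D) * A\<^sup>D = A\<^sup>D * (1 - B * B\<^sup>D)"
    using commute_minus_one[OF QAD[symmetric]] .
  have QB: "(1 - B * B\<^sup>D) * B = B * (1 - B * B\<^sup>D)"
    using commute_minus_one[OF drazin_projection(2)[OF dB]] .
  have Qx: "(1 - B * B\<^sup>D) * (- (A\<^sup>D * B)) = - (A\<^sup>D * B) * (1 - B * B\<^sup>D)"
  proof -
    have "(1 - B * B\<^sup>D) * (A\<^sup>D * B) = A\<^sup>D * B * (1 - B * B\<^sup>D)"
      by (metis QE QB mult.assoc)
    then show ?thesis
      by simp
  qed
  have shift: "A\<^sup>D * (- (B * A\<^sup>D)) ^ n = (- (A\<^sup>D * B)) ^ n * A\<^sup>D" for n
  proof (induction n)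
    case (Suc n)
    have "A\<^sup>D * (- (B * A\<^sup>D)) ^ Suc n = - (A\<^sup>D * B) * (A\<^sup>D * (- (B * A\<^sup>D)) ^ n)"
      by (simp add: mult.assoc)
    then show ?case
      using Suc by (simp add: mult.assoc)
  qed simp
  have Qpow: "(1 - B * B\<^sup>D) * (- (A\<^sup>D * B)) ^ n = (- (A\<^sup>D * B)) ^ n * (1 - B * B\<^sup>D)" for n
    using power_commuting_commutes[OF Qx[symmetric], of n] by simp
  have "nilpotent_part_inverse B A =
      (\<Sum>n<drazin_index B. (1 - B * B\<^sup>D) * (A\<^sup>D * (- (B * A\<^sup>D)) ^ n))"
    by (simp add: nilpotent_part_inverse_def sum_distrib_left mult.assoc)
  also have "\<dots> = (\<Sum>n<drazin_index B. (- (A\<^sup>D * B)) ^ n * A\<^sup>D * (1 - B * B\<^sup>D))"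
  proof (intro sum.cong refl)
    fix n
    have "(1 - B * B\<^sup>D) * ((- (A\<^sup>D * B)) ^ n * A\<^sup>D)
        = ((1 - B * B\<^sup>D) * (- (A\<^sup>D * B)) ^ n) * A\<^sup>D"
      by (simp only: mult.assoc)
    also have "\<dots> = (- (A\<^sup>D * B)) ^ n * A\<^sup>D * (1 - B * B\<^sup>D)"
      by (simp only: Qpow mult.assoc QE)
    finally show "(1 - B * B\<^sup>D) * (A\<^sup>D * (- (B * A\<^sup>D)) ^ n)
        = (- (A\<^sup>D * B)) ^ n * A\<^sup>D * (1 - B * B\<^sup>D)"
      by (simp only: shift)
  qed
  also have "\<dots> = (\<Sum>n<drazin_index B. (A\<^sup>D) ^ (2 * n) * (- (A * B)) ^ n) * A\<^sup>D * (1 - B * B\<^sup>D)"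
    by (simp add: sum_distrib_right power_prod_drazin(2)[OF A weakly_commutative_imp_fst[OF AB]])
  finally show ?thesis .
qed

text \<open>Since \<open>B B\<^sup>D\<close> and \<open>A\<close> commute, \<open>A + B\<close> and \<open>(1 - x) B\<close> with \<open>x = - A B\<^sup>D\<close> agree after
  multiplication by \<open>B B\<^sup>D\<close>; and \<open>x\<close> is nilpotent on the corner of \<open>1 - A A\<^sup>D\<close>, of exponent at most
  the index of \<open>A\<close>.\<close>

lemma add_mult_nilpotent_part_inverse:
  fixes A B :: "'r::{ring, monoid_mult}"
  assumes A: "drazin_invertible A" and B: "drazin_invertible B" and AB: "weakly_commutative A B"
  shows "(A + B) * nilpotent_part_inverse A B = (1 - A * A\<^sup>D) * (B * B\<^sup>D)"
    and "nilpotent_part_inverse A B * (A + B) = (1 - A * A\<^sup>D) * (B * B\<^sup>D)"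
    and "(1 - A * A\<^sup>D) * nilpotent_part_inverse A B = nilpotent_part_inverse A B"
    and "B * B\<^sup>D * nilpotent_part_inverse A B = nilpotent_part_inverse A B"
proof -
  note dA = drazin_invertible_is_drazin_inverse[OF A]
    and dB = drazin_invertible_is_drazin_inverse[OF B]
    and fst = weakly_commutative_imp_fst[OF AB]
    and fst' = weakly_commutative_imp_fst[OF weakly_commutative_sym[OF AB]]
  define E Q where "E = 1 - A * A\<^sup>D" and "Q = B * B\<^sup>D"
  define k x where "k = drazin_index A" and "x = - (A * B\<^sup>D)"
  define G where "G = (\<Sum>n<k. x ^ n)"
  have T: "nilpotent_part_inverse A B = E * B\<^sup>D * G"
    by (simp add: nilpotent_part_inverse_def E_def k_def x_def G_def)
  have cB: "B * B\<^sup>D = B\<^sup>D * B"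
    using dB by (simp add: is_drazin_inverse_def)
  have EE: "E * E = E"
    unfolding E_def by (rule idempotent_complement[OF drazin_projection(1)[OF dA]])
  have PB: "A * A\<^sup>D * B = B * (A * A\<^sup>D)"
    by (rule drazin_projection_commute[OF dA fst])
  have EA: "E * A = A * E"
    unfolding E_def by (rule commute_minus_one[OF drazin_projection(2)[OF dA]])
  have EB: "E * B = B * E"
    unfolding E_def by (rule commute_minus_one[OF PB])
  have EBD: "E * B\<^sup>D = B\<^sup>D * E"
    using drazin_inverse_commute[OF dB EB[symmetric]] by simp
  have EQ: "E * Q = Q * E"
    unfolding Q_def by (metis EB EBD mult.assoc)
  have QA: "Q * A = A * Q"
    unfolding Q_def by (rule drazin_projection_commute[OF dB fst'])
  have Q: "Q * Q = Q" "Q * B = B * Q" "Q * B\<^sup>D = B\<^sup>D" "B\<^sup>D * Q = B\<^sup>D" "B\<^sup>D * B = Q"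
    using drazin_projection[OF dB] by (simp_all add: Q_def cB[symmetric])
  have "Q * (A * B\<^sup>D) = A * B\<^sup>D * Q"
    by (metis Q(3,4) QA mult.assoc)
  then have "Q * x = x * Q"
    by (simp add: x_def)
  then have QG: "Q * G = G * Q"
    using power_commuting_commutes[of x Q]
    by (simp add: G_def sum_distrib_left sum_distrib_right)
  have Ek: "E * A ^ k = 0"
    using power_drazin_index[OF A] power_commuting_commutes[OF EA[symmetric]]
    by (simp add: E_def k_def)
  obtain X where X: "(- (A * B)) ^ k = A ^ k * X"
    using fst_weakly_commutative_prod_power[OF fst] by blast
  have "x ^ k = A ^ k * (X * (B\<^sup>D) ^ (2 * k))"
    using power_prod_drazin(1)[OF B fst', of k] by (simp add: x_def X mult.assoc)
  then have "E * x ^ k = 0"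
    using Ek by (metis mult.assoc mult_zero_left)
  then have Egeo: "E * ((1 - x) * G) = E" "E * (G * (1 - x)) = E"
    unfolding G_def geometric_sum_inverse by (simp_all add: right_diff_distrib)
  have "(1 - x) * B = B + A * (B\<^sup>D * B)"
    by (simp add: x_def distrib_right mult.assoc)
  then have SQ: "(1 - x) * B * Q = (A + B) * Q"
    using Q by (simp add: distrib_right mult.assoc add.commute)
  have ES: "E * (A + B) = (A + B) * E" and QS: "Q * (A + B) = (A + B) * Q"
    using EA EB QA Q by (simp_all add: distrib_left distrib_right)
  show "(1 - A * A\<^sup>D) * nilpotent_part_inverse A B = nilpotent_part_inverse A B"
    unfolding T E_def[symmetric] by (metis EE mult.assoc)
  show "B * B\<^sup>D * nilpotent_part_inverse A B = nilpotent_part_inverse A B"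
    unfolding T Q_def[symmetric] by (metis EQ Q(3) mult.assoc)
  have "(A + B) * (E * B\<^sup>D * G) = E * ((A + B) * Q) * B\<^sup>D * G"
    by (metis ES Q(3) mult.assoc)
  also have "\<dots> = E * (1 - x) * (B * (Q * B\<^sup>D)) * G"
    unfolding SQ[symmetric] by (simp only: mult.assoc)
  also have "\<dots> = E * ((1 - x) * G) * Q"
    by (simp only: Q(3) Q_def[symmetric] mult.assoc QG)
  finally show "(A + B) * nilpotent_part_inverse A B = (1 - A * A\<^sup>D) * (B * B\<^sup>D)"
    by (simp only: T Egeo E_def[symmetric] Q_def[symmetric])
  have "E * B\<^sup>D * G * (A + B) = B\<^sup>D * E * (Q * G) * (A + B)"
    by (metis EBD EQ Q(4) mult.assoc)
  also have "\<dots> = B\<^sup>D * E * G * ((A + B) * Q)"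
    by (simp only: QG QS mult.assoc)
  also have "\<dots> = B\<^sup>D * (E * (G * (1 - x))) * (B * Q)"
    unfolding SQ[symmetric] by (simp only: mult.assoc)
  also have "\<dots> = E * ((B\<^sup>D * B) * Q)"
    by (simp only: Egeo EBD[symmetric] mult.assoc)
  finally show "nilpotent_part_inverse A B * (A + B) = (1 - A * A\<^sup>D) * (B * B\<^sup>D)"
    by (simp only: T Q E_def[symmetric] Q_def[symmetric])
qed

section \<open>The Drazin inverse of the sum\<close>

text \<open>If \<open>A^i\<close> and \<open>B^j\<close> vanish on this corner, so does \<open>(A + B)^(i + j)\<close>, which lies in
  \<open>A^i R + B^j R\<close>.\<close>

lemma nilpotent_doubly_nilpotent_part:
  fixes A B :: "'r::{ring, monoid_mult}"
  assumes A: "drazin_invertible A" and B: "drazin_invertible B" and AB: "weakly_commutative A B"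
  shows "nilpotent ((A + B) * ((1 - A * A\<^sup>D) * (1 - B * B\<^sup>D)))"
proof -
  note dA = drazin_invertible_is_drazin_inverse[OF A]
    and dB = drazin_invertible_is_drazin_inverse[OF B]
    and fst = weakly_commutative_imp_fst[OF AB]
    and fst' = weakly_commutative_imp_fst[OF weakly_commutative_sym[OF AB]]
  define E F where "E = 1 - A * A\<^sup>D" and "F = 1 - B * B\<^sup>D"
  have EA: "E * A = A * E" and EB: "E * B = B * E" and FA: "F * A = A * F" and FB: "F * B = B * F"
    unfolding E_def F_def
    using drazin_projection(2)[OF dA] drazin_projection(2)[OF dB]
      drazin_projection_commute[OF dA fst] drazin_projection_commute[OF dB fst']
    by (simp_all only: commute_minus_one)
  have EBD: "E * B\<^sup>D = B\<^sup>D * E"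
    using drazin_inverse_commute[OF dB EB[symmetric]] by simp
  have "B * B\<^sup>D * E = E * (B * B\<^sup>D)"
    by (metis EB EBD mult.assoc)
  then have FE: "F * E = E * F"
    unfolding F_def by (rule commute_minus_one)
  have EE: "E * E = E" and FF: "F * F = F"
    unfolding E_def F_def by (intro idempotent_complement drazin_projection dA dB)+
  have NN: "E * F * (E * F) = E * F"
    by (metis EE FF FE mult.assoc)
  have NS: "E * F * (A + B) = (A + B) * (E * F)"
    using EA EB FA FB by (simp add: distrib_left distrib_right) (metis mult.assoc)
  define i j where "i = drazin_index A" and "j = drazin_index B"
  have Ei: "E * A ^ i = 0" and Fj: "F * B ^ j = 0"
    using power_drazin_index[OF A] power_drazin_index[OF B]
      power_commuting_commutes[OF EA[symmetric]] power_commuting_commutes[OF FB[symmetric]]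
    by (simp_all add: E_def F_def i_def j_def)
  obtain X Y where XY: "(A + B) ^ (i + j) = A ^ i * X + B ^ j * Y"
    using weakly_commutative_add_power[OF AB] by blast
  have "E * F * (A ^ i * X) = F * (E * A ^ i) * X"
    by (simp only: FE[symmetric] mult.assoc)
  moreover have "E * F * (B ^ j * Y) = E * (F * B ^ j) * Y"
    by (simp only: mult.assoc)
  ultimately have "E * F * (A + B) ^ (i + j) = 0"
    by (simp add: XY distrib_left Ei Fj)
  then have "(A + B) ^ (i + j) * (E * F) = 0"
    using power_commuting_commutes[OF NS[symmetric]] by simp
  then show ?thesis
    using nilpotent_corner[OF NN NS] by (simp add: E_def F_def)
qed

text \<open>The two products differ by the nilpotent summand of \<open>A + B\<close> on the corner where both
  operators are nilpotent, so they have the same Drazin inverse. The second form, in which that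
  summand is missing, allows this corner to be counted only once in the decomposition of \<open>A + B\<close>
  into three summands.\<close>

lemma is_drazin_inverse_nilpotent_part:
  fixes A B :: "'r::{ring, monoid_mult}"
  assumes A: "drazin_invertible A" and B: "drazin_invertible B" and AB: "weakly_commutative A B"
  shows "is_drazin_inverse ((1 - A * A\<^sup>D) * (A + B)) (nilpotent_part_inverse A B)"
    and "is_drazin_inverse ((1 - A * A\<^sup>D) * (B * B\<^sup>D) * (A + B)) (nilpotent_part_inverse A B)"
proof -
  note dA = drazin_invertible_is_drazin_inverse[OF A]
    and dB = drazin_invertible_is_drazin_inverse[OF B]
    and fst = weakly_commutative_imp_fst[OF AB]
    and fst' = weakly_commutative_imp_fst[OF weakly_commutative_sym[OF AB]]
  define E Q S T where "E = 1 - A * A\<^sup>D" and "Q = B * B\<^sup>D" and "S = A + B"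
    and "T = nilpotent_part_inverse A B"
  have T: "S * T = E * Q" "T * S = E * Q" "E * T = T" "Q * T = T"
    using add_mult_nilpotent_part_inverse[OF assms] by (simp_all add: E_def Q_def S_def T_def)
  have EA: "E * A = A * E" and EB: "E * B = B * E"
    unfolding E_def using drazin_projection(2)[OF dA] drazin_projection_commute[OF dA fst]
    by (simp_all only: commute_minus_one)
  have "E * B\<^sup>D = B\<^sup>D * E"
    using drazin_inverse_commute[OF dB EB[symmetric]] by simp
  then have EQ: "E * Q = Q * E"
    unfolding Q_def by (metis EB mult.assoc)
  have QS: "Q * S = S * Q" and ES: "E * S = S * E"
    using EA EB drazin_projection(2)[OF dB] drazin_projection_commute[OF dB fst']
    by (simp_all add: S_def Q_def distrib_left distrib_right)
  have EE: "E * E = E" and QQ: "Q * Q = Q"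
    unfolding E_def Q_def by (intro idempotent_complement drazin_projection dA dB)+
  \<comment> \<open>As \<open>T = T S T\<close>, the corner that absorbs \<open>T\<close> on the left also does so on the right.\<close>
  have TE: "T * E = T" "T * Q = T"
  proof -
    have "T = T * S * T"
      using T by (simp add: mult.assoc)
    also have "\<dots> = T * (S * T)"
      by (rule mult.assoc)
    finally have "T = T * (E * Q)"
      using T by simp
    then show "T * E = T" "T * Q = T"
      by (metis EE QQ EQ mult.assoc)+
  qed
  have 1: "E * S * T = E * Q" "T * (E * S) = E * Q"
    using T TE EE by (metis mult.assoc)+
  have 2: "E * Q * S * T = E * Q" "T * (E * Q * S) = E * Q"
    using T TE EE QQ EQ by (metis mult.assoc)+
  have T': "E * Q * T = T"
    using T by (simp add: mult.assoc)
  have "nilpotent (E * S * (1 - E * Q))"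
  proof -
    have "E * S * (1 - E * Q) = S * (E * (1 - Q))"
      by (simp add: right_diff_distrib mult.assoc) (metis ES EE mult.assoc)
    then show ?thesis
      using nilpotent_doubly_nilpotent_part[OF assms] by (simp add: E_def Q_def S_def)
  qed
  then show "is_drazin_inverse ((1 - A * A\<^sup>D) * (A + B)) (nilpotent_part_inverse A B)"
    unfolding is_drazin_inverse_def E_def[symmetric] S_def[symmetric] T_def[symmetric]
    by (simp add: 1 T')
  have "E * Q * S * (1 - E * Q) = 0"
    by (simp add: right_diff_distrib) (metis ES QS EE QQ EQ mult.assoc)
  then have "(E * Q * S * (1 - E * Q)) ^ 1 = 0"
    by simp
  then have "nilpotent (E * Q * S * (1 - E * Q))"
    unfolding nilpotent_def by blast
  then show "is_drazin_inverse ((1 - A * A\<^sup>D) * (B * B\<^sup>D) * (A + B)) (nilpotent_part_inverse A B)"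
    unfolding is_drazin_inverse_def E_def[symmetric] Q_def[symmetric] S_def[symmetric] T_def[symmetric]
    by (simp add: 2 T')
qed

lemma drazin_inverse_add_eq:
  fixes X Y D :: "'r::{ring, monoid_mult}"
  assumes "drazin_invertible X" and "is_drazin_inverse Y D" and "X * Y = 0" "Y * X = 0"
  shows "drazin_invertible (X + Y)" "(X + Y)\<^sup>D = X\<^sup>D + D"
  using is_drazin_inverse_add[OF drazin_invertible_is_drazin_inverse[OF assms(1)] assms(2-)]
  by (auto simp: drazin_invertible_def intro: drazin_inverse_eq)

lemma orthogonal_parts:
  fixes S U V :: "'r::{ring, monoid_mult}"
  assumes "V * S = S * V" and "U * V = 0"
  shows "U * S * (V * S) = 0"
proof -
  have "U * S * (V * S) = U * V * (S * S)"
    by (simp only: assms(1) mult.assoc) (simp only: assms(1)[symmetric] mult.assoc[symmetric])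
  then show ?thesis
    by (simp add: assms(2))
qed

lemma drazin_projections_commute_add:
  fixes A B :: "'r::{ring, monoid_mult}"
  assumes A: "drazin_invertible A" and B: "drazin_invertible B" and AB: "weakly_commutative A B"
  shows "A * A\<^sup>D * (A + B) = (A + B) * (A * A\<^sup>D)" "B * B\<^sup>D * (A + B) = (A + B) * (B * B\<^sup>D)"
    and "A * A\<^sup>D * (B * B\<^sup>D) = B * B\<^sup>D * (A * A\<^sup>D)"
proof -
  note dA = drazin_invertible_is_drazin_inverse[OF A]
    and dB = drazin_invertible_is_drazin_inverse[OF B]
  have PB: "A * A\<^sup>D * B = B * (A * A\<^sup>D)"
    using drazin_projection_commute[OF dA weakly_commutative_imp_fst[OF AB]] .
  have QA: "B * B\<^sup>D * A = A * (B * B\<^sup>D)"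
    using drazin_projection_commute[OF dB weakly_commutative_imp_fst[OF weakly_commutative_sym[OF AB]]] .
  show "A * A\<^sup>D * (A + B) = (A + B) * (A * A\<^sup>D)" "B * B\<^sup>D * (A + B) = (A + B) * (B * B\<^sup>D)"
    by (simp_all only: distrib_left distrib_right PB QA
        drazin_projection(2)[OF dA] drazin_projection(2)[OF dB])
  have "fst_weakly_commutative B (A * A\<^sup>D)"
    unfolding fst_weakly_commutative_def using PB by metis
  then show "A * A\<^sup>D * (B * B\<^sup>D) = B * B\<^sup>D * (A * A\<^sup>D)"
    using drazin_projection_commute[OF dB] by simp
qed

lemma drazin_inverse_add_left_part:
  fixes A B :: "'r::{ring, monoid_mult}"
  assumes A: "drazin_invertible A" and B: "drazin_invertible B" and AB: "weakly_commutative A B"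
    and S: "drazin_invertible (A * A\<^sup>D * (A + B))"
  shows "drazin_invertible (A + B)"
    and "(A + B)\<^sup>D = (A * A\<^sup>D * (A + B))\<^sup>D + nilpotent_part_inverse A B"
proof -
  define P where "P = A * A\<^sup>D"
  have PP: "P * P = P" and PS: "P * (A + B) = (A + B) * P"
    unfolding P_def using drazin_projection(1) drazin_invertible_is_drazin_inverse A
      drazin_projections_commute_add(1)[OF A B AB] by blast+
  have "P * (1 - P) = 0" "(1 - P) * P = 0"
    by (simp_all add: PP left_diff_distrib right_diff_distrib)
  then have "P * (A + B) * ((1 - P) * (A + B)) = 0" "(1 - P) * (A + B) * (P * (A + B)) = 0"
    using orthogonal_parts PS commute_minus_one[OF PS] by blast+
  note sum = drazin_inverse_add_eq[OF S is_drazin_inverse_nilpotent_part(1)[OF A B AB],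
      folded P_def, OF this]
  have "P * (A + B) + (1 - P) * (A + B) = A + B"
    by (simp add: left_diff_distrib)
  with sum show "drazin_invertible (A + B)"
    "(A + B)\<^sup>D = (A * A\<^sup>D * (A + B))\<^sup>D + nilpotent_part_inverse A B"
    by (simp_all add: P_def)
qed

lemma drazin_inverse_add_common_part:
  fixes A B :: "'r::{ring, monoid_mult}"
  assumes A: "drazin_invertible A" and B: "drazin_invertible B" and AB: "weakly_commutative A B"
    and S: "drazin_invertible (A * A\<^sup>D * (B * B\<^sup>D) * (A + B))"
  shows "drazin_invertible (A + B)"
    and "(A + B)\<^sup>D = (A * A\<^sup>D * (B * B\<^sup>D) * (A + B))\<^sup>D
      + (nilpotent_part_inverse A B + nilpotent_part_inverse B A)"
proof -
  \<comment> \<open>The decomposition is \<open>1 = P Q + (1 - P) + (1 - Q) P\<close>.\<close>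
  define P Q where "P = A * A\<^sup>D" and "Q = B * B\<^sup>D"
  have PP: "P * P = P" and QQ: "Q * Q = Q"
    unfolding P_def Q_def using drazin_projection(1) drazin_invertible_is_drazin_inverse A B
    by blast+
  have PS: "P * (A + B) = (A + B) * P" and QS: "Q * (A + B) = (A + B) * Q" and PQ: "P * Q = Q * P"
    unfolding P_def Q_def by (rule drazin_projections_commute_add[OF A B AB])+
  have ES: "(1 - P) * (A + B) = (A + B) * (1 - P)" and FS: "(1 - Q) * (A + B) = (A + B) * (1 - Q)"
    using PS QS by (simp_all only: commute_minus_one)
  have PE: "P * (1 - P) = 0" "(1 - P) * P = 0" and QF: "Q * (1 - Q) = 0" "(1 - Q) * Q = 0"
    and FP: "(1 - Q) * P = P * (1 - Q)"
    by (simp_all add: PP QQ PQ left_diff_distrib right_diff_distrib)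
  have PQS: "P * Q * (A + B) = (A + B) * (P * Q)"
    by (simp only: mult.assoc QS) (simp only: mult.assoc[symmetric] PS)
  have FPS: "(1 - Q) * P * (A + B) = (A + B) * ((1 - Q) * P)"
    by (simp only: mult.assoc PS) (simp only: mult.assoc[symmetric] FS)
  have zero: "(1 - P) * ((1 - Q) * P) = 0" "(1 - Q) * P * (1 - P) = 0"
    "P * Q * (1 - P) = 0" "(1 - P) * (P * Q) = 0"
    "P * Q * ((1 - Q) * P) = 0" "(1 - Q) * P * (P * Q) = 0"
  proof -
    show "(1 - P) * ((1 - Q) * P) = 0" "(1 - P) * (P * Q) = 0"
      by (simp_all add: FP mult.assoc[symmetric] PE)
    show "(1 - Q) * P * (1 - P) = 0"
      by (simp add: mult.assoc PE)
    show "P * Q * (1 - P) = 0"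
      by (simp add: PQ mult.assoc PE)
    have "P * Q * ((1 - Q) * P) = P * (Q * (1 - Q)) * P"
      by (simp only: mult.assoc)
    then show "P * Q * ((1 - Q) * P) = 0"
      by (simp add: QF)
    have "(1 - Q) * P * (P * Q) = P * ((1 - Q) * Q) * P"
      by (simp only: FP PQ) (simp only: mult.assoc)
    then show "(1 - Q) * P * (P * Q) = 0"
      by (simp add: QF)
  qed
  have T: "is_drazin_inverse ((1 - P) * (A + B) + (1 - Q) * P * (A + B))
      (nilpotent_part_inverse A B + nilpotent_part_inverse B A)"
  proof (rule is_drazin_inverse_add)
    show "is_drazin_inverse ((1 - P) * (A + B)) (nilpotent_part_inverse A B)"
      unfolding P_def by (rule is_drazin_inverse_nilpotent_part(1)[OF A B AB])
    show "is_drazin_inverse ((1 - Q) * P * (A + B)) (nilpotent_part_inverse B A)"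
      using is_drazin_inverse_nilpotent_part(2)[OF B A weakly_commutative_sym[OF AB]]
      by (simp only: P_def Q_def add.commute[of B])
    show "(1 - P) * (A + B) * ((1 - Q) * P * (A + B)) = 0"
      "(1 - Q) * P * (A + B) * ((1 - P) * (A + B)) = 0"
      using orthogonal_parts zero ES FPS by blast+
  qed
  have "P * Q * (A + B) * ((1 - P) * (A + B)) = 0" "P * Q * (A + B) * ((1 - Q) * P * (A + B)) = 0"
    "(1 - P) * (A + B) * (P * Q * (A + B)) = 0" "(1 - Q) * P * (A + B) * (P * Q * (A + B)) = 0"
    using orthogonal_parts zero ES FPS PQS by blast+
  then have "P * Q * (A + B) * ((1 - P) * (A + B) + (1 - Q) * P * (A + B)) = 0"
    "((1 - P) * (A + B) + (1 - Q) * P * (A + B)) * (P * Q * (A + B)) = 0"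
    by (simp_all only: distrib_left[of "P * Q * (A + B)"] distrib_right[of _ _ "P * Q * (A + B)"]
        add_0_left)
  note sum = drazin_inverse_add_eq[OF S[folded P_def Q_def] T this]
  have "P * Q * (A + B) + ((1 - P) * (A + B) + (1 - Q) * P * (A + B))
      = (P * Q + (1 - P) + (1 - Q) * P) * (A + B)"
    by (simp only: distrib_right[of _ _ "A + B"] add.assoc)
  also have "P * Q + (1 - P) + (1 - Q) * P = 1"
    by (simp add: PQ left_diff_distrib)
  finally show "drazin_invertible (A + B)" "(A + B)\<^sup>D = (A * A\<^sup>D * (B * B\<^sup>D) * (A + B))\<^sup>D
      + (nilpotent_part_inverse A B + nilpotent_part_inverse B A)"
    using sum unfolding P_def Q_def by simp_all
qed

theorem corollary2p13:
  fixes A B :: "'a::complex_banach bounded_op"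
  assumes "drazin_invertible A" and "drazin_invertible B"
    and "weakly_commutative A B"
  shows "(drazin_invertible (A * A\<^sup>D * (A + B) * B * B\<^sup>D) \<longrightarrow>
      drazin_invertible (A + B) \<and>
      (A + B)\<^sup>D = (A * A\<^sup>D * (A + B) * B * B\<^sup>D)\<^sup>D
        + (1 - A * A\<^sup>D) * B\<^sup>D * (\<Sum>n<drazin_index A. (- (A * B)) ^ n * (B\<^sup>D) ^ (2 * n))
        + (\<Sum>n<drazin_index B. (A\<^sup>D) ^ (2 * n) * (- (A * B)) ^ n) * A\<^sup>D * (1 - B * B\<^sup>D))
    \<and> (drazin_invertible (A * A\<^sup>D * (A + B)) \<longrightarrow>
      drazin_invertible (A + B) \<and>
      (A + B)\<^sup>D = (A * A\<^sup>D * (A + B))\<^sup>D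
        + (1 - A * A\<^sup>D) * B\<^sup>D * (\<Sum>n<drazin_index A. (- (A * B)) ^ n * (B\<^sup>D) ^ (2 * n)))
    \<and> (drazin_invertible ((A + B) * B * B\<^sup>D) \<longrightarrow>
      drazin_invertible (A + B) \<and>
      (A + B)\<^sup>D = ((A + B) * B * B\<^sup>D)\<^sup>D
        + (\<Sum>n<drazin_index B. (A\<^sup>D) ^ (2 * n) * (- (A * B)) ^ n) * A\<^sup>D * (1 - B * B\<^sup>D))"
proof -
  note AB = assms
  note BA = assms(2) assms(1) weakly_commutative_sym[OF assms(3)]
  note T = nilpotent_part_inverse_eq[OF assms(2,3)] nilpotent_part_inverse_swap_eq[OF AB]
  note QS = drazin_projections_commute_add(2)[OF AB]
  have "A * A\<^sup>D * (A + B) * B * B\<^sup>D = A * A\<^sup>D * ((A + B) * (B * B\<^sup>D))"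
    by (simp only: mult.assoc)
  also have "\<dots> = A * A\<^sup>D * (B * B\<^sup>D) * (A + B)"
    by (simp only: QS[symmetric]) (simp only: mult.assoc)
  finally have common: "A * A\<^sup>D * (A + B) * B * B\<^sup>D = A * A\<^sup>D * (B * B\<^sup>D) * (A + B)" .
  have "(A + B) * B * B\<^sup>D = (A + B) * (B * B\<^sup>D)"
    by (rule mult.assoc)
  then have right: "(A + B) * B * B\<^sup>D = B * B\<^sup>D * (B + A)"
    by (simp only: QS[symmetric] add.commute[of B])
  show ?thesis
    unfolding T[symmetric] common right
    using drazin_inverse_add_common_part[OF AB] drazin_inverse_add_left_part[OF AB]
      drazin_inverse_add_left_part[OF BA]
    by (simp add: add.commute[of B] add.assoc)
qed

end
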